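(* Let $p$ and $q$ be monic polynomials of degree $d$ having only nonnegative real roots. Then for every $w>0$, \[ \widetilde{\mathcal{S}}_{p\boxtimes_d q}(w)\le \widetilde{\mathcal{S}}_p(w)\,\widetilde{\mathcal{S}}_q(w). \]
   Context: For a polynomial $p$ of degree $d$ with real roots $\lambda_1,\dots,\lambda_d$, $\mathcal{G}_p(z)=\frac1d\sum_i\frac1{z-\lambda_i}$ and $\widetilde{\mathcal{M}}_p(z)=z\mathcal{G}_p(z)-1=\frac1d\sum_i\sum_{j\ge1}(\lambda_i/z)^j$. $\widetilde{\mathcal{M}}^{-1}_p(w)$ denotes the largest $z$ with $\widetilde{\mathcal{M}}_p(z)=w$, and $\widetilde{\mathcal{S}}_p(w)=\frac{w}{w+1}\widetilde{\mathcal{M}}^{-1}_p(w)$. The symmetric multiplicative convolution: for $p=\sum_i x^{d-i}(-1)^ia_i$, $q=\sum_ix^{d-i}(-1)^ib_i$, $p\boxtimes_d q=\sum_{i=0}^d x^{d-i}(-1)^i a_ib_i/\binom{d}{i}$; equivalently $\mathbb{E}_Q\det(xI-AQBQ^T)$ for positive semidefinite $A,B$ with characteristic polynomials $p,q$ and Haar-random orthogonal $Q$. *)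

theory Defs
  imports "HOL-Analysis.Analysis" "HOL-Computational_Algebra.Computational_Algebra"
begin

definition nonneg_rooted :: "real poly \<Rightarrow> bool" where
  "nonneg_rooted p \<longleftrightarrow>
     (\<forall>z::complex. poly (map_poly complex_of_real p) z = 0 \<longrightarrow> z \<in> \<real>\<^sub>\<ge>\<^sub>0)"

text \<open>
  The roots are counted with multiplicity. Since \<open>proots\<close> collects real roots only, the
  transforms below have their intended meaning for real-rooted polynomials.
\<close>

definition cauchy_transform :: "real poly \<Rightarrow> real \<Rightarrow> real" where
  "cauchy_transform p z = 1 / real (degree p) * (\<Sum>x\<in>#proots p. 1 / (z - x))"

definition M_transform :: "real poly \<Rightarrow> real \<Rightarrow> real" where
  "M_transform p z = z * cauchy_transform p z - 1"

text \<open>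
  The largest preimage of \<open>w\<close>, where \<open>poly p z \<noteq> 0\<close> excludes the poles (on which the totalised
  division gives the transform a meaningless value). If \<open>p\<close> has only nonnegative roots, not all
  of them \<open>0\<close>, then a largest preimage of every \<open>w > 0\<close> exists. For \<open>p = x\<^sup>d\<close> the transform
  vanishes identically and there is no preimage; the value is then \<open>0\<close>, which is the limit of
  the inverse as the roots tend to \<open>0\<close>.
\<close>

definition is_M_preimage :: "real poly \<Rightarrow> real \<Rightarrow> real \<Rightarrow> bool" where
  "is_M_preimage p w z \<longleftrightarrow> poly p z \<noteq> 0 \<and> M_transform p z = w"

definition M_inverse :: "real poly \<Rightarrow> real \<Rightarrow> real" where
  "M_inverse p w =
     (if \<exists>z. is_M_preimage p w z \<and> (\<forall>y. is_M_preimage p w y \<longrightarrow> y \<le> z)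
      then GREATEST z. is_M_preimage p w z
      else 0)"

definition S_transform :: "real poly \<Rightarrow> real \<Rightarrow> real" where
  "S_transform p w = w / (w + 1) * M_inverse p w"

text \<open>The coefficient \<open>a\<^sub>i\<close> in \<open>p = (\<Sum>i\<le>d. (-1)^i a\<^sub>i x^(d-i))\<close>.\<close>

definition signed_coeff :: "nat \<Rightarrow> real poly \<Rightarrow> nat \<Rightarrow> real" where
  "signed_coeff d p i = (-1) ^ i * coeff p (d - i)"

definition sym_mult_conv :: "nat \<Rightarrow> real poly \<Rightarrow> real poly \<Rightarrow> real poly" where
  "sym_mult_conv d p q =
     (\<Sum>i\<le>d. monom ((-1) ^ i * (signed_coeff d p i * signed_coeff d q i / real (d choose i))) (d - i))"

end

theory Submission
  imports Defs
begin

text \<open>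
  For \<open>p\<close> of degree \<open>d\<close> and \<open>c = d (1 + w)\<close>, the equation \<open>M_transform p z = w\<close> says that
  \<open>c p - x p'\<close> vanishes at \<open>z\<close>, and this operator acts diagonally on monomials. So one has to show
  that \<open>c r - x r'\<close>, for \<open>r\<close> the convolution, is positive beyond \<open>w / (w + 1) y \<theta>\<close>, where \<open>y\<close> and \<open>\<theta>\<close>
  are the inverse values of \<open>p\<close> and \<open>q\<close>. The roots \<open>a\<close> of \<open>p\<close> enter through \<open>t = y / (y - a) \<ge> 1\<close>,
  whose average is \<open>1 + w\<close>. Two of these values on either side of the average can be moved: with
  \<open>t\<^sub>1 + t\<^sub>2\<close> fixed, \<open>p\<close> is a convex combination of a polynomial with one more value equal to
  the average and of a polynomial with the root \<open>0\<close>. When all values agree, \<open>r\<close> is a rescaling of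
  \<open>q\<close>. For a root \<open>0\<close>, the convolution of \<open>x f\<close> and \<open>q\<close> in degree \<open>d\<close> is \<open>x\<close> times that of \<open>f\<close> and
  \<open>q' / d\<close> in degree \<open>d - 1\<close>; passing to \<open>c - 1\<close> and to the Newton step of \<open>q\<close> at \<open>\<theta>\<close> leaves the
  bound unchanged, so induction on the degree applies.

  That \<open>r\<close> has only nonnegative roots (Szego's composition theorem) follows from Laguerre's theorem
  on polar derivatives: if \<open>z\<close> is not a nonnegative real, a line separates the roots of \<open>p\<close> from the
  points \<open>z / b\<close>, where \<open>b\<close> runs over the positive roots of \<open>q\<close>.
\<close>

subsection \<open>Polynomials given by their roots\<close>

definition root_poly :: "'a::field multiset \<Rightarrow> 'a poly" where
  "root_poly A = (\<Prod>a\<in>#A. [:- a, 1:])"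

lemma root_poly_empty [simp]: "root_poly {#} = 1"
  and root_poly_add [simp]: "root_poly (add_mset a A) = [:- a, 1:] * root_poly A"
  by (simp_all add: root_poly_def)

lemma root_poly_nonzero [simp]: "root_poly A \<noteq> 0"
  by (induction A) (auto simp del: mult_pCons_left)

lemma degree_root_poly [simp]: "degree (root_poly A) = size A"
  by (induction A) (auto simp: degree_mult_eq simp del: mult_pCons_left)

lemma lead_coeff_root_poly [simp]: "coeff (root_poly A) (size A) = 1"
proof -
  have "lead_coeff (root_poly A) = 1"
    by (induction A) (auto simp only: lead_coeff_mult root_poly_empty root_poly_add, auto)
  then show ?thesis by simp
qed

lemma poly_root_poly_eq_0_iff: "poly (root_poly A) x = 0 \<longleftrightarrow> x \<in># A"
  by (induction A) auto

lemma poly_root_poly_pos: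
  fixes x :: real
  shows "(\<And>a. a \<in># A \<Longrightarrow> a < x) \<Longrightarrow> 0 < poly (root_poly A) x"
  by (induction A) (auto simp del: mult_pCons_left)

lemma proots_root_poly [simp]: "proots (root_poly A) = A"
  by (induction A) (auto simp: proots_mult simp del: mult_pCons_left)

lemma pderiv_root_poly_add:
  "pderiv (root_poly (add_mset a A)) = root_poly A + [:- a, 1:] * pderiv (root_poly A)"
  unfolding root_poly_add pderiv_mult by (simp add: pderiv_pCons)

lemma poly_pderiv_root_poly_add:
  "poly (pderiv (root_poly (add_mset a A))) x =
    poly (root_poly A) x + (x - a) * poly (pderiv (root_poly A)) x"
  unfolding pderiv_root_poly_add poly_add poly_mult by simp

lemma poly_pderiv_root_poly:
  assumes "x \<notin># A"
  shows "poly (pderiv (root_poly A)) x = poly (root_poly A) x * (\<Sum>a\<in>#A. 1 / (x - a))"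
  using assms
proof (induction A)
  case (add a A)
  then show ?case by (simp only: poly_pderiv_root_poly_add) (auto simp: field_simps)
qed (auto simp: pderiv_1)

text \<open>Differentiating p' = p S once more gives p (S^2 + S'), and S' is minus the sum of
  squares.\<close>

lemma poly_pderiv2_root_poly:
  assumes "x \<notin># A"
  shows "poly (pderiv (pderiv (root_poly A))) x =
    poly (root_poly A) x * ((\<Sum>a\<in>#A. 1 / (x - a))\<^sup>2 - (\<Sum>a\<in>#A. (1 / (x - a))\<^sup>2))"
  using assms
proof (induction A)
  case (add a A)
  define S where "S = (\<Sum>a\<in>#A. 1 / (x - a))"
  define T where "T = (\<Sum>a\<in>#A. (1 / (x - a))\<^sup>2)"
  define Q where "Q = poly (root_poly A) x"
  have "poly (pderiv (pderiv (root_poly (add_mset a A)))) x =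
      2 * poly (pderiv (root_poly A)) x + (x - a) * poly (pderiv (pderiv (root_poly A))) x"
    unfolding pderiv_root_poly_add pderiv_add pderiv_mult poly_add poly_mult
    by (simp add: pderiv_pCons)
  also have "\<dots> = 2 * (Q * S) + (x - a) * (Q * (S\<^sup>2 - T))"
    using add poly_pderiv_root_poly[of x A] by (simp add: S_def T_def Q_def)
  also have "\<dots> = (x - a) * Q * ((1 / (x - a) + S)\<^sup>2 - ((1 / (x - a))\<^sup>2 + T))"
  proof -
    have "2 * (Q * S) + e * (Q * (S\<^sup>2 - T)) = e * Q * ((1 / e + S)\<^sup>2 - ((1 / e)\<^sup>2 + T))"
      if "e \<noteq> 0" for e :: 'a
      using that by (simp add: field_simps power2_eq_square)
    from this[of "x - a"] show ?thesis using add.prems by simp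
  qed
  finally show ?case
    by (simp add: S_def T_def Q_def algebra_simps)
qed (auto simp: pderiv_1)

section \<open>Inequalities for sums over multisets\<close>

lemma sum_mset_pos:
  fixes f :: "'a \<Rightarrow> 'b::ordered_comm_monoid_add"
  assumes "A \<noteq> {#}" "\<And>x. x \<in># A \<Longrightarrow> 0 < f x"
  shows "0 < (\<Sum>x\<in>#A. f x)"
  using assms
proof (induction A)
  case (add a A)
  then show ?case by (cases "A = {#}") (auto intro: add_pos_pos)
qed auto

text \<open>The difference of the two sides is the sum of the expression in the hypothesis over
  unordered pairs of entries. For positive \<open>f\<close>, the hypothesis says that
  \<open>f\<close> and g / f are oppositely ordered.\<close>

lemma sum_mset_le_times_sum_mset:
  fixes f g :: "'a \<Rightarrow> real"
  assumes "\<And>x y. x \<in># A \<Longrightarrow> y \<in># A \<Longrightarrow> 0 \<le> (f y - f x) * (g x * f y - g y * f x)"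
  shows "(\<Sum>x\<in>#A. f x * g x) * (\<Sum>x\<in>#A. f x) \<le> (\<Sum>x\<in>#A. g x) * (\<Sum>x\<in>#A. (f x)\<^sup>2)"
  using assms
proof (induction A)
  case (add a A)
  have "(\<Sum>x\<in>#A. f x * g x) * f a + f a * g a * (\<Sum>x\<in>#A. f x)
      = (\<Sum>x\<in>#A. f x * g x * f a + f a * g a * f x)"
    by (simp add: sum_mset.distrib sum_mset_distrib_left sum_mset_distrib_right)
  also have "\<dots> \<le> (\<Sum>x\<in>#A. g x * (f a)\<^sup>2 + g a * (f x)\<^sup>2)"
  proof (rule sum_mset_mono)
    fix x assume "x \<in># A"
    then have "0 \<le> (f a - f x) * (g x * f a - g a * f x)"
      using add.prems[of x a] by simp
    then show "f x * g x * f a + f a * g a * f x \<le> g x * (f a)\<^sup>2 + g a * (f x)\<^sup>2"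
      by (simp add: algebra_simps power2_eq_square)
  qed
  also have "\<dots> = (\<Sum>x\<in>#A. g x) * (f a)\<^sup>2 + g a * (\<Sum>x\<in>#A. (f x)\<^sup>2)"
    by (simp add: sum_mset.distrib sum_mset_distrib_left sum_mset_distrib_right)
  finally show ?case
    using add by (simp add: algebra_simps power2_eq_square)
qed auto

section \<open>From complex zeros to real linear factors\<close>

lemma poly_complex_of_real [simp]:
  "poly (map_poly complex_of_real p) (complex_of_real x) = complex_of_real (poly p x)"
  by (induction p) (auto simp: map_poly_pCons)

lemma map_poly_of_real_mult:
  "map_poly complex_of_real (p * q) = map_poly complex_of_real p * map_poly complex_of_real q"
  by (rule poly_eqI) (simp add: coeff_map_poly coeff_mult)

lemma map_poly_of_real_root_poly:
  "map_poly complex_of_real (root_poly A) = root_poly (image_mset complex_of_real A)"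
  by (induction A) (auto simp: map_poly_of_real_mult map_poly_pCons simp del: mult_pCons_left)

text \<open>The fundamental theorem of algebra supplies a complex zero, which
  \<open>nonneg_rooted\<close> makes real and nonnegative; dividing out its linear factor lowers the
  degree.\<close>

lemma nonneg_rooted_imp_root_poly:
  assumes "lead_coeff p = 1" "nonneg_rooted p"
  shows "p = root_poly (proots p) \<and> (\<forall>a\<in>#proots p. 0 \<le> a)"
  using assms
proof (induction "degree p" arbitrary: p)
  case 0
  then have "p = 1" by (metis degree_eq_zeroE lead_coeff_pCons(2) one_pCons)
  then show ?case by simp
next
  case (Suc n)
  have "degree (map_poly complex_of_real p) \<noteq> 0"
    using Suc by (simp add: degree_map_poly)
  then obtain z where z: "poly (map_poly complex_of_real p) z = 0"
    by (metis fundamental_theorem_of_algebra constant_degree)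
  then have "z \<in> \<real>\<^sub>\<ge>\<^sub>0" using Suc by (auto simp: nonneg_rooted_def)
  then obtain x where x: "z = complex_of_real x" "0 \<le> x"
    by (auto simp: nonneg_Reals_def)
  then have "poly p x = 0" using z by simp
  then obtain q where q: "p = [:- x, 1:] * q" by (auto simp: poly_eq_0_iff_dvd)
  have "p \<noteq> 0" using Suc by auto
  then have "q \<noteq> 0" using q by auto
  have "n = degree q" using Suc(2) \<open>q \<noteq> 0\<close> by (simp add: q degree_mult_eq del: mult_pCons_left)
  moreover have "lead_coeff q = 1"
    using Suc(3) unfolding q lead_coeff_mult by simp
  moreover have "nonneg_rooted q"
    using Suc(4) unfolding nonneg_rooted_def q map_poly_of_real_mult by simp
  ultimately have IH: "q = root_poly (proots q)" "\<forall>a\<in>#proots q. 0 \<le> a" using Suc(1) by auto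
  have "proots p = add_mset x (proots q)"
    unfolding q using \<open>q \<noteq> 0\<close> by (subst proots_mult) (auto simp del: mult_pCons_left)
  then show ?case using IH q x by auto
qed

text \<open>A Gauss-Lucas argument: at a zero \<open>z\<close> outside \<open>B\<close> the
  reciprocals of z - b sum to 0, and real and imaginary parts exhibit \<open>z\<close> as the
  average of the roots with positive weights \<open>r a\<close>.\<close>

lemma nonneg_rooted_pderiv_root_poly:
  assumes "\<And>a. a \<in># A \<Longrightarrow> 0 \<le> a" "A \<noteq> {#}"
  shows "nonneg_rooted (pderiv (root_poly A))"
  unfolding nonneg_rooted_def
proof (intro allI impI)
  fix z assume "poly (map_poly complex_of_real (pderiv (root_poly A))) z = 0"
  define B where "B = image_mset complex_of_real A"
  have "map_poly complex_of_real (pderiv (root_poly A)) = pderiv (root_poly B)"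
    unfolding B_def map_poly_of_real_root_poly[symmetric]
    by (rule poly_eqI) (simp add: coeff_map_poly coeff_pderiv)
  then have z: "poly (pderiv (root_poly B)) z = 0"
    using \<open>poly _ z = 0\<close> by simp
  show "z \<in> \<real>\<^sub>\<ge>\<^sub>0"
  proof (cases "z \<in># B")
    case True then show ?thesis using assms by (auto simp: B_def)
  next
    case False
    define r where "r a = 1 / (cmod (z - complex_of_real a))\<^sup>2" for a
    have r: "r a > 0" if "a \<in># A" for a
      using False that by (auto simp: r_def B_def)
    have *: "1 / (z - complex_of_real a) = complex_of_real (r a) * cnj (z - complex_of_real a)" for a
      by (subst complex_div_cnj) (simp add: r_def)
    have "(\<Sum>b\<in>#B. 1 / (z - b)) = 0"
      using z False poly_pderiv_root_poly[of z B] by (auto simp: poly_root_poly_eq_0_iff)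
    then have S: "(\<Sum>a\<in>#A. complex_of_real (r a) * cnj (z - complex_of_real a)) = 0"
      unfolding B_def image_mset.compositionality * [symmetric] by (simp add: o_def)
    have "Re (\<Sum>a\<in>#C. complex_of_real (r a) * cnj (z - complex_of_real a)) = (\<Sum>a\<in>#C. r a * (Re z - a))"
      "Im (\<Sum>a\<in>#C. complex_of_real (r a) * cnj (z - complex_of_real a)) = - (\<Sum>a\<in>#C. r a) * Im z" for C
      by (induction C) (auto simp: algebra_simps)
    with S have Re: "(\<Sum>a\<in>#A. r a * (Re z - a)) = 0" and Im: "(\<Sum>a\<in>#A. r a) * Im z = 0"
      by (metis complex.sel(1) zero_complex.code, metis complex.sel(2) zero_complex.code mult_minus_left neg_equal_0_iff_equal)
    have P: "(\<Sum>a\<in>#A. r a) > 0" using assms r by (intro sum_mset_pos) auto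
    then have "Im z = 0" using Im by auto
    moreover have "Re z \<ge> 0"
    proof -
      have "(\<Sum>a\<in>#A. r a) * Re z = (\<Sum>a\<in>#A. r a * (Re z - a)) + (\<Sum>a\<in>#A. r a * a)"
        by (simp flip: sum_mset.distrib add: algebra_simps sum_mset_distrib_left)
      moreover have "(\<Sum>a\<in>#A. r a * a) \<ge> (\<Sum>a\<in>#A. 0)"
        using r assms by (intro sum_mset_mono) (simp add: less_imp_le)
      ultimately have "0 \<le> (\<Sum>a\<in>#A. r a) * Re z" using Re by simp
      then show ?thesis using P by (simp add: zero_le_mult_iff)
    qed
    ultimately show ?thesis by (simp add: complex_nonneg_Reals_iff)
  qed
qed

subsection \<open>The convolution preserves nonnegative roots\<close>

text \<open>Only \<open>i = d - k\<close> contributes to degree \<open>k\<close>, and the three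
  signs there merge into one.\<close>

lemma coeff_sym_mult_conv:
  "coeff (sym_mult_conv d p q) k =
    (if k \<le> d then (-1) ^ (d - k) * coeff p k * coeff q k / real (d choose k) else 0)"
proof -
  have "coeff (sym_mult_conv d p q) k = (\<Sum>i\<le>d. if k = d - i then
      (-1) ^ i * (signed_coeff d p i * signed_coeff d q i / real (d choose i)) else 0)"
    by (simp add: sym_mult_conv_def coeff_sum eq_commute cong: if_cong)
  also have "\<dots> = (\<Sum>i\<in>(if k \<le> d then {d - k} else {}).
      (-1) ^ i * (signed_coeff d p i * signed_coeff d q i / real (d choose i)))"
    by (subst sum.inter_filter[symmetric]) (simp, intro sum.cong, auto)
  also have "\<dots> = (if k \<le> d then (-1) ^ (d - k) * coeff p k * coeff q k / real (d choose k) else 0)"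
    by (auto simp: signed_coeff_def binomial_symmetric[of k d] simp flip: power_add mult_2)
  finally show ?thesis .
qed

lemma sym_mult_conv_add_left:
  "sym_mult_conv d (p + p') q = sym_mult_conv d p q + sym_mult_conv d p' q"
  by (rule poly_eqI) (simp add: coeff_sym_mult_conv add_divide_distrib algebra_simps)

lemma sym_mult_conv_smult_left: "sym_mult_conv d (smult c p) q = smult c (sym_mult_conv d p q)"
  by (rule poly_eqI) (simp add: coeff_sym_mult_conv)

lemma degree_sym_mult_conv_le: "degree (sym_mult_conv d p q) \<le> d"
  by (rule degree_le) (simp add: coeff_sym_mult_conv)

lemma sym_mult_conv_monic:
  assumes "lead_coeff p = 1" "degree p = d" "lead_coeff q = 1" "degree q = d"
  shows "degree (sym_mult_conv d p q) = d" "lead_coeff (sym_mult_conv d p q) = 1"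
proof -
  have c: "coeff (sym_mult_conv d p q) d = 1"
    using assms by (auto simp: coeff_sym_mult_conv)
  then show "degree (sym_mult_conv d p q) = d"
    using degree_sym_mult_conv_le[of d p q] le_degree[of "sym_mult_conv d p q" d] by simp
  with c show "lead_coeff (sym_mult_conv d p q) = 1" by simp
qed

text \<open>Shifting the exponent changes the binomial by a factor (j + 1) / (n + 1), which is what
  the derivative divided by n + 1 supplies. This lowers the degree when one factor has the root
  0.\<close>

lemma sym_mult_conv_pCons_0:
  "sym_mult_conv (Suc n) ([:0, 1:] * f) q =
    [:0, 1:] * sym_mult_conv n f (smult (1 / real (Suc n)) (pderiv q))"
proof (rule poly_eqI)
  fix k
  show "coeff (sym_mult_conv (Suc n) ([:0, 1:] * f) q) k =
    coeff ([:0, 1:] * sym_mult_conv n f (smult (1 / real (Suc n)) (pderiv q))) k"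
  proof (cases k)
    case (Suc j)
    have "real (Suc j) * real (Suc n choose Suc j) = real (Suc n) * real (n choose j)"
      by (metis Suc_times_binomial of_nat_mult)
    moreover have "j \<le> n \<Longrightarrow> real (n choose j) > 0" "j \<le> n \<Longrightarrow> real (Suc n choose Suc j) > 0"
      using zero_less_binomial by (auto simp del: binomial_Suc_Suc)
    ultimately show ?thesis
      by (simp add: Suc coeff_sym_mult_conv coeff_pderiv divide_simps del: binomial_Suc_Suc of_nat_Suc)
  qed (simp add: coeff_sym_mult_conv)
qed

section \<open>Apolarity and Laguerre's polar derivative\<close>

definition apolar_pairing :: "nat \<Rightarrow> complex poly \<Rightarrow> complex poly \<Rightarrow> complex" where
  "apolar_pairing n p g = (\<Sum>k\<le>n. (-1) ^ k * coeff p (n - k) * coeff g k / of_nat (n choose k))"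

text \<open>The polar derivative with pole \<open>a\<close>, divided by \<open>n\<close>. Here
  \<open>n\<close> is a formal degree that may exceed that of \<open>g\<close>.\<close>

definition polar_deriv :: "nat \<Rightarrow> complex \<Rightarrow> complex poly \<Rightarrow> complex poly" where
  "polar_deriv n a g = g - smult (1 / of_nat n) ([:- a, 1:] * pderiv g)"

lemma coeff_polar_deriv:
  assumes "n > 0"
  shows "coeff (polar_deriv n a g) k =
    ((of_nat n - of_nat k) * coeff g k + a * of_nat (Suc k) * coeff g (Suc k)) / of_nat n"
  using assms by (cases k) (auto simp: polar_deriv_def coeff_pderiv field_simps)

lemma degree_polar_deriv_le:
  assumes "degree g \<le> Suc n"
  shows "degree (polar_deriv (Suc n) a g) \<le> n"
proof (rule degree_le, intro allI impI)
  fix k assume "n < k"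
  then have "coeff g (Suc k) = 0" "k = Suc n \<or> coeff g k = 0"
    using assms by (auto intro!: coeff_eq_0)
  then show "coeff (polar_deriv (Suc n) a g) k = 0"
    by (auto simp: coeff_polar_deriv)
qed

text \<open>Multiplication by x - a is adjoint to the polar derivative with pole \<open>a\<close>,
  so roots can be moved across the pairing one at a time.\<close>

lemma apolar_pairing_linear_factor:
  assumes "degree f \<le> n"
  shows "apolar_pairing (Suc n) ([:- a, 1:] * f) g = apolar_pairing n f (polar_deriv (Suc n) a g)"
proof -
  define F where "F k = (-1) ^ k * coeff f (n - k)" for k
  let ?N = "of_nat (Suc n) :: complex"
  \<comment> \<open>These two identities express the reciprocals of both binomials for n + 1 by
    those for n; the numerators are the ones in \<open>coeff_polar_deriv\<close>.\<close>
  have 1: "?N * of_nat (n choose k) = of_nat (Suc k) * of_nat (Suc n choose Suc k)" for k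
    by (metis Suc_times_binomial of_nat_mult)
  have 2: "?N * of_nat (n choose k) = (?N - of_nat k) * of_nat (Suc n choose k)" if "k \<le> n" for k
  proof -
    have "Suc n * (n choose k) = (Suc n - k) * (Suc n choose k)"
      using that binomial_absorb_comp[of "Suc n" k] by simp
    then have "?N * of_nat (n choose k) = of_nat (Suc n - k) * of_nat (Suc n choose k)"
      by (metis of_nat_mult)
    then show ?thesis using that by (simp add: of_nat_diff)
  qed
  have nz: "of_nat (n choose k) \<noteq> (0::complex)" "of_nat (Suc n choose k) \<noteq> (0::complex)"
    "of_nat (Suc n choose Suc k) \<noteq> (0::complex)" if "k \<le> n" for k
    using that by (auto simp del: binomial_Suc_Suc)
  have c: "(-1) ^ k * coeff ([:- a, 1:] * f) (Suc n - k) =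
      (if k \<le> n then F k else 0) + (case k of 0 \<Rightarrow> 0 | Suc j \<Rightarrow> a * F j)" if "k \<le> Suc n" for k
  proof -
    \<comment> \<open>This matters for \<open>k = 0\<close>: the top coefficient of the product also
      contains - a times this one.\<close>
    have "coeff f (Suc n) = 0" using assms by (simp add: coeff_eq_0)
    then show ?thesis
      using that by (cases "k = Suc n") (auto simp: F_def Suc_diff_le Suc_diff_Suc algebra_simps split: nat.splits)
  qed
  have "apolar_pairing (Suc n) ([:- a, 1:] * f) g =
      (\<Sum>k\<le>Suc n. ((if k \<le> n then F k else 0) + (case k of 0 \<Rightarrow> 0 | Suc j \<Rightarrow> a * F j)) *
        coeff g k / of_nat (Suc n choose k))"
    unfolding apolar_pairing_def
    by (rule sum.cong[OF refl]) (simp only: c atMost_iff mult.assoc[symmetric])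
  also have "\<dots> = (\<Sum>k\<le>Suc n. (if k \<le> n then F k else 0) * coeff g k / of_nat (Suc n choose k)) +
      (\<Sum>k\<le>Suc n. (case k of 0 \<Rightarrow> 0 | Suc j \<Rightarrow> a * F j) * coeff g k / of_nat (Suc n choose k))"
    by (simp only: distrib_right add_divide_distrib sum.distrib)
  also have "(\<Sum>k\<le>Suc n. (if k \<le> n then F k else 0) * coeff g k / of_nat (Suc n choose k)) =
      (\<Sum>k\<le>n. F k * coeff g k / of_nat (Suc n choose k))"
    by (subst sum.atMost_Suc) (simp del: binomial_Suc_Suc)
  also have "(\<Sum>k\<le>Suc n. (case k of 0 \<Rightarrow> 0 | Suc j \<Rightarrow> a * F j) * coeff g k / of_nat (Suc n choose k)) =
      (\<Sum>k\<le>n. a * F k * coeff g (Suc k) / of_nat (Suc n choose Suc k))"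
    by (subst sum.atMost_Suc_shift) (simp del: binomial_Suc_Suc)
  also have "(\<Sum>k\<le>n. F k * coeff g k / of_nat (Suc n choose k)) +
      (\<Sum>k\<le>n. a * F k * coeff g (Suc k) / of_nat (Suc n choose Suc k)) =
      (\<Sum>k\<le>n. F k * (coeff g k / of_nat (Suc n choose k) + a * coeff g (Suc k) / of_nat (Suc n choose Suc k)))"
    by (simp add: sum.distrib[symmetric] algebra_simps del: binomial_Suc_Suc)
  also have "\<dots> = (\<Sum>k\<le>n. F k * (coeff (polar_deriv (Suc n) a g) k / of_nat (n choose k)))"
  proof (intro sum.cong refl arg_cong2[of _ _ _ _ "(*)"])
    fix k assume "k \<in> {..n}"
    then have k: "k \<le> n" by simp
    have 3: "1 / of_nat (Suc n choose k) = (?N - of_nat k) / (?N * of_nat (n choose k))"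
      using nz[OF k] 2[OF k] by (simp add: divide_simps del: binomial_Suc_Suc of_nat_Suc)
    have 4: "1 / of_nat (Suc n choose Suc k) = of_nat (Suc k) / (?N * of_nat (n choose k))"
      using nz[OF k] 1[of k] by (simp add: divide_simps del: binomial_Suc_Suc of_nat_Suc)
    have "coeff g k / of_nat (Suc n choose k) + a * coeff g (Suc k) / of_nat (Suc n choose Suc k) =
      coeff g k * (1 / of_nat (Suc n choose k)) + a * coeff g (Suc k) * (1 / of_nat (Suc n choose Suc k))"
      by simp
    also have "\<dots> = coeff (polar_deriv (Suc n) a g) k / of_nat (n choose k)"
      unfolding 3 4 coeff_polar_deriv[OF zero_less_Suc]
      by (simp add: add_divide_distrib diff_divide_distrib algebra_simps del: binomial_Suc_Suc of_nat_Suc)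
    finally show "coeff g k / of_nat (Suc n choose k) + a * coeff g (Suc k) / of_nat (Suc n choose Suc k) =
      coeff (polar_deriv (Suc n) a g) k / of_nat (n choose k)" .
  qed
  also have "\<dots> = apolar_pairing n f (polar_deriv (Suc n) a g)"
    by (simp add: apolar_pairing_def F_def)
  finally show ?thesis .
qed

text \<open>After clearing denominators, the disc condition says that \<open>v\<close> is no farther
  from 2 \<delta> than from 0.\<close>

lemma cmod_inverse_minus_half:
  assumes "0 < \<delta>" "v \<noteq> 0"
  shows "cmod (1 / v - complex_of_real (1 / (2 * \<delta>))) \<le> 1 / (2 * \<delta>) \<longleftrightarrow> \<delta> \<le> Re v"
proof -
  have "1 / v - complex_of_real (1 / (2 * \<delta>)) = (complex_of_real (2 * \<delta>) - v) / (v * complex_of_real (2 * \<delta>))"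
    using assms by (simp add: field_simps)
  then have "cmod (1 / v - complex_of_real (1 / (2 * \<delta>))) = cmod (complex_of_real (2 * \<delta>) - v) / (cmod v * (2 * \<delta>))"
    using assms by (simp add: norm_divide norm_mult)
  also have "\<dots> \<le> 1 / (2 * \<delta>) \<longleftrightarrow> cmod (complex_of_real (2 * \<delta>) - v) \<le> cmod v"
    using assms by (simp add: divide_simps)
  also have "\<dots> \<longleftrightarrow> (cmod (complex_of_real (2 * \<delta>) - v))\<^sup>2 \<le> (cmod v)\<^sup>2"
    by (simp add: abs_le_square_iff[symmetric])
  also have "\<dots> \<longleftrightarrow> 4 * \<delta> * \<delta> \<le> 4 * \<delta> * Re v"
    by (simp only: cmod_power2) (simp add: power2_eq_square algebra_simps)
  also have "\<dots> \<longleftrightarrow> \<delta> \<le> Re v" using assms by simp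
  finally show ?thesis .
qed

lemma cmod_sum_mset_le: "cmod (\<Sum>x\<in>#A. f x) \<le> (\<Sum>x\<in>#A. cmod (f x))"
proof (induction A)
  case (add a A)
  then show ?case using norm_triangle_ineq[of "f a" "\<Sum>x\<in>#A. f x"] by simp
qed auto

text \<open>
  Laguerre's theorem for a half-plane. The map \<open>\<rho> \<mapsto> 1 / (u - \<rho>)\<close> sends the complement of the
  half-plane into a closed disc through \<open>0\<close>, and \<open>0\<close> accounts for the roots at infinity when the
  degree is less than \<open>n\<close>.
\<close>

lemma polar_deriv_nonzero_on_half_plane:
  assumes g: "degree g \<le> n" "\<And>u. poly g u = 0 \<Longrightarrow> Re (\<alpha> * u) \<le> \<beta>"
    and "n > 0" "Re (\<alpha> * a) > \<beta>" "Re (\<alpha> * u) > \<beta>"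
  shows "poly (polar_deriv n a g) u \<noteq> 0"
proof
  assume *: "poly (polar_deriv n a g) u = 0"
  define R where "R = proots g"
  have "g \<noteq> 0" using g(2)[of a] assms(4) by auto
  have gR: "g = smult (lead_coeff g) (root_poly R)"
    unfolding R_def root_poly_def by (rule complex_poly_decompose_multiset[symmetric])
  have gu: "poly g u \<noteq> 0" using g(2)[of u] assms(5) by auto
  have uR: "u \<notin># R" using gu \<open>g \<noteq> 0\<close> by (simp add: R_def)
  define \<delta> where "\<delta> = Re (\<alpha> * u) - \<beta>"
  have "\<delta> > 0" using assms by (simp add: \<delta>_def)
  define v where "v = \<alpha> * (u - a)"
  define h where "h = complex_of_real (1 / (2 * \<delta>))"
  have "poly (pderiv g) u = poly g u * (\<Sum>b\<in>#R. 1 / (u - b))"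
    by (subst (1 2) gR) (simp add: pderiv_smult poly_pderiv_root_poly[OF uR])
  then have "poly g u * (1 - (u - a) * (\<Sum>b\<in>#R. 1 / (u - b)) / of_nat n) = 0"
    using * by (simp add: polar_deriv_def algebra_simps add_divide_distrib diff_divide_distrib)
  then have 1: "(u - a) * (\<Sum>b\<in>#R. 1 / (u - b)) = of_nat n"
    using gu \<open>n > 0\<close> by auto
  then have "u \<noteq> a" using \<open>n > 0\<close> by auto
  have "R \<noteq> {#}" using 1 \<open>n > 0\<close> by auto
  then obtain b where "b \<in># R" by blast
  then have "Re (\<alpha> * b) \<le> \<beta>" using g(2)[of b] \<open>g \<noteq> 0\<close> by (simp add: R_def)
  then have "\<alpha> \<noteq> 0" using assms(4) by auto
  then have "v \<noteq> 0" using \<open>u \<noteq> a\<close> by (simp add: v_def)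
  have "(\<Sum>b\<in>#R. 1 / (\<alpha> * (u - b))) = (\<Sum>b\<in>#R. 1 / (u - b)) / \<alpha>"
    by (simp add: sum_mset_distrib_left divide_inverse mult.commute)
  also have "\<dots> = of_nat n / v"
    using 1 \<open>\<alpha> \<noteq> 0\<close> \<open>u \<noteq> a\<close> by (simp add: v_def field_simps)
  finally have 2: "(\<Sum>b\<in>#R. 1 / (\<alpha> * (u - b))) = of_nat n / v" .
  have "size R = degree g" by (simp add: R_def size_proots_complex)
  then have sz: "size R \<le> n" using g by simp
  \<comment> \<open>By \<open>2\<close>, 1 / v is the mean of n points of the disc with centre
    \<open>h\<close>, absent roots contributing the point 0. But \<open>Re v < \<delta>\<close> puts
    1 / v outside that disc.\<close>
  have "Re v < \<delta>" using assms by (simp add: v_def \<delta>_def algebra_simps)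
  then have "cmod (1 / v - h) > 1 / (2 * \<delta>)"
    using cmod_inverse_minus_half[OF \<open>\<delta> > 0\<close> \<open>v \<noteq> 0\<close>] by (simp add: h_def)
  then have "real n * (1 / (2 * \<delta>)) < real n * cmod (1 / v - h)"
    using \<open>n > 0\<close> by (intro mult_strict_left_mono) auto
  also have "\<dots> = cmod (of_nat n / v - of_nat n * h)"
  proof -
    have "of_nat n / v - of_nat n * h = of_nat n * (1 / v - h)" by (simp add: right_diff_distrib)
    then show ?thesis by (simp only: norm_mult norm_of_nat)
  qed
  also have "of_nat n / v - of_nat n * h = (\<Sum>b\<in>#R. 1 / (\<alpha> * (u - b)) - h) - of_nat (n - size R) * h"
    using sz unfolding 2[symmetric] sum_mset.distrib diff_conv_add_uminus[of _ h]
    by (simp add: of_nat_diff algebra_simps)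
  also have "cmod \<dots> \<le> (\<Sum>b\<in>#R. cmod (1 / (\<alpha> * (u - b)) - h)) + real (n - size R) * (1 / (2 * \<delta>))"
    using \<open>\<delta> > 0\<close> by (intro order.trans[OF norm_triangle_ineq4] add_mono cmod_sum_mset_le)
       (simp add: norm_mult norm_divide h_def)
  also have "(\<Sum>b\<in>#R. cmod (1 / (\<alpha> * (u - b)) - h)) \<le> (\<Sum>b\<in>#R. 1 / (2 * \<delta>))"
  proof (rule sum_mset_mono)
    fix b assume b: "b \<in># R"
    then have "poly g b = 0" using \<open>g \<noteq> 0\<close> by (simp add: R_def)
    then have "\<delta> \<le> Re (\<alpha> * (u - b))" using g(2)[of b] by (simp add: \<delta>_def algebra_simps)
    moreover have "\<alpha> * (u - b) \<noteq> 0" using b uR \<open>\<alpha> \<noteq> 0\<close> by auto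
    ultimately show "cmod (1 / (\<alpha> * (u - b)) - h) \<le> 1 / (2 * \<delta>)"
      using cmod_inverse_minus_half[OF \<open>\<delta> > 0\<close>] by (simp add: h_def)
  qed
  also have "(\<Sum>b\<in>#R. 1 / (2 * \<delta>)) + real (n - size R) * (1 / (2 * \<delta>)) = real n * (1 / (2 * \<delta>))"
    using sz by (simp add: of_nat_diff flip: add_divide_distrib)
  finally show False by simp
qed

text \<open>Grace's theorem for a half-plane. Each root of \<open>A\<close> is exchanged for a polar
  derivative of \<open>g\<close>, whose zeros stay in the half-plane by Laguerre; when
  \<open>A\<close> is used up, a nonzero constant is left.\<close>

lemma apolar_pairing_nonzero:
  assumes "degree g \<le> size A" "g \<noteq> 0" "\<And>u. poly g u = 0 \<Longrightarrow> Re (\<alpha> * u) \<le> \<beta>"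
    and "\<And>a. a \<in># A \<Longrightarrow> Re (\<alpha> * a) > \<beta>"
  shows "apolar_pairing (size A) (root_poly A) g \<noteq> 0"
  using assms
proof (induction A arbitrary: g)
  case empty
  then show ?case by (auto simp: apolar_pairing_def elim!: degree_eq_zeroE)
next
  case (add a A)
  let ?h = "polar_deriv (Suc (size A)) a g"
  have nz: "poly ?h u \<noteq> 0" if "Re (\<alpha> * u) > \<beta>" for u
    using add.prems that by (intro polar_deriv_nonzero_on_half_plane[of _ _ \<alpha> \<beta>]) auto
  have "apolar_pairing (size A) (root_poly A) ?h \<noteq> 0"
  proof (rule add.IH)
    show "degree ?h \<le> size A" using add.prems by (intro degree_polar_deriv_le) auto
    show "?h \<noteq> 0" using nz[of a] add.prems by auto
    show "Re (\<alpha> * u) \<le> \<beta>" if "poly ?h u = 0" for u using nz[of u] that by force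
  qed (use add.prems in auto)
  then show ?case
    by (simp only: root_poly_add size_add_mset apolar_pairing_linear_factor degree_root_poly order_refl) simp
qed

lemma poly_eq_sum_atMost:
  fixes p :: "'a::comm_semiring_1 poly"
  assumes "degree p \<le> n"
  shows "poly p x = (\<Sum>i\<le>n. coeff p i * x ^ i)"
  unfolding poly_altdef by (rule sum.mono_neutral_left) (use assms in \<open>auto simp: coeff_eq_0\<close>)

text \<open>The value of the convolution at \<open>z\<close> is the apolar pairing of
  \<open>p\<close> with the reversal of q(z x), to which Grace's theorem applies.\<close>

lemma nonneg_rooted_sym_mult_conv:
  assumes "lead_coeff p = 1" "degree p = d" "nonneg_rooted p"
    and "lead_coeff q = 1" "degree q = d" "nonneg_rooted q"
  shows "nonneg_rooted (sym_mult_conv d p q)"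
  unfolding nonneg_rooted_def
proof (intro allI impI, rule ccontr)
  fix z assume r0: "poly (map_poly complex_of_real (sym_mult_conv d p q)) z = 0"
    and z: "z \<notin> \<real>\<^sub>\<ge>\<^sub>0"
  define A where "A = proots p"
  define B where "B = proots q"
  have A: "p = root_poly A" "\<And>a. a \<in># A \<Longrightarrow> 0 \<le> a"
    using nonneg_rooted_imp_root_poly[of p] assms by (auto simp: A_def)
  have B: "q = root_poly B" "\<And>b. b \<in># B \<Longrightarrow> 0 \<le> b"
    using nonneg_rooted_imp_root_poly[of q] assms by (auto simp: B_def)
  have "z \<noteq> 0" using z by auto
  define Q where "Q = map_poly complex_of_real q"
  \<comment> \<open>As a function of u, \<open>g\<close> is u^d q(z / u): its zeros are z / b for
    the positive roots b of \<open>q\<close>, while roots 0 of \<open>q\<close> only lower its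
    degree.\<close>
  define g where "g = reflect_poly (pcompose Q [:0, z:])"
  have dQ: "degree (pcompose Q [:0, z:]) = d"
    using assms \<open>z \<noteq> 0\<close> by (simp add: Q_def degree_map_poly degree_pcompose)
  have cQ: "coeff (pcompose Q [:0, z:]) k = complex_of_real (coeff q k) * z ^ k" for k
    by (simp add: Q_def coeff_pcompose_linear coeff_map_poly)
  have g0: "poly g 0 \<noteq> 0"
    using assms \<open>z \<noteq> 0\<close> dQ unfolding g_def poly_reflect_poly_0 cQ by auto
  have groots: "\<exists>b>0. b \<in># B \<and> u = z / complex_of_real b" if "poly g u = 0" for u
  proof -
    have "u \<noteq> 0" using g0 that by auto
    then have "poly Q (z / u) = 0"
      using that by (simp add: g_def poly_reflect_poly_nz poly_pcompose field_simps)
    then obtain b where b: "b \<in># B" "z / u = complex_of_real b"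
      by (auto simp: Q_def B(1) map_poly_of_real_root_poly poly_root_poly_eq_0_iff)
    then have "b \<noteq> 0" using \<open>z \<noteq> 0\<close> \<open>u \<noteq> 0\<close> by auto
    then show ?thesis using b B(2)[of b] \<open>u \<noteq> 0\<close> by (intro exI[of _ b]) (auto simp: field_simps)
  qed
  \<comment> \<open>Inserting 1 keeps \<open>m\<close> positive even if \<open>q\<close> has no
    positive root.\<close>
  define m where "m = Max (insert 1 (set_mset B))"
  have m: "m > 0" "\<And>b. b \<in># B \<Longrightarrow> b \<le> m"
    by (auto simp: m_def Max_gr_iff)
  \<comment> \<open>Multiplication by \<alpha> sends \<open>z\<close> into the open left half-plane
    and keeps the nonnegative reals in the closed right one.\<close>
  obtain \<alpha> where \<alpha>: "Re (\<alpha> * z) < 0" "Re \<alpha> \<ge> 0"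
  proof -
    consider "Im z > 0" | "Im z < 0" | "Im z = 0" "Re z < 0"
      using z by (fastforce simp: complex_nonneg_Reals_iff)
    then show ?thesis
      using that[of \<i>] that[of "-\<i>"] that[of 1] by cases auto
  qed
  \<comment> \<open>As \<open>Re (\<alpha> * z)\<close> is negative, dividing it by a larger b moves
    it to the right; dividing by \<open>m\<close> therefore bounds all the values at z / b.\<close>
  define \<beta> where "\<beta> = Re (\<alpha> * z) / m"
  have "apolar_pairing (size (image_mset complex_of_real A)) (root_poly (image_mset complex_of_real A)) g \<noteq> 0"
  proof (rule apolar_pairing_nonzero)
    show "degree g \<le> size (image_mset complex_of_real A)"
      using degree_reflect_poly_le[of "pcompose Q [:0, z:]"] assms dQ A by (simp add: g_def)
    show "g \<noteq> 0" using g0 by auto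
    show "Re (\<alpha> * u) \<le> \<beta>" if "poly g u = 0" for u
    proof -
      obtain b where b: "b > 0" "b \<in># B" "u = z / complex_of_real b"
        using groots \<open>poly g u = 0\<close> by blast
      then have "Re (\<alpha> * u) = Re (\<alpha> * z) / b" by (simp add: Re_divide_of_real[symmetric])
      also have "\<dots> \<le> \<beta>" unfolding \<beta>_def using b m \<alpha> by (intro divide_left_mono_neg) auto
      finally show ?thesis .
    qed
    show "Re (\<alpha> * a) > \<beta>" if a: "a \<in># image_mset complex_of_real A" for a
    proof -
      obtain a' where "a = complex_of_real a'" "a' \<ge> 0" using a A by auto
      then have "Re (\<alpha> * a) \<ge> 0" using \<alpha> by auto
      moreover have "\<beta> < 0" using \<alpha> m by (simp add: \<beta>_def divide_neg_pos)
      ultimately show ?thesis by simp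
    qed
  qed
  moreover have "size A = d" using assms A by simp
  ultimately have "apolar_pairing d (map_poly complex_of_real p) g \<noteq> 0"
    by (simp add: A(1) map_poly_of_real_root_poly)
  also have "apolar_pairing d (map_poly complex_of_real p) g =
      (\<Sum>k\<le>d. (-1) ^ (d - k) * complex_of_real (coeff p k) * (complex_of_real (coeff q k) * z ^ k) / of_nat (d choose k))"
    unfolding apolar_pairing_def
    by (subst sum.nat_diff_reindex[symmetric, of _ "Suc d", unfolded lessThan_Suc_atMost])
       (auto simp: g_def coeff_reflect_poly dQ cQ coeff_map_poly binomial_symmetric[symmetric] intro!: sum.cong)
  also have "\<dots> = poly (map_poly complex_of_real (sym_mult_conv d p q)) z"
    by (subst poly_eq_sum_atMost[of _ d])
       (auto simp: coeff_map_poly coeff_sym_mult_conv degree_map_poly degree_sym_mult_conv_le intro!: sum.cong)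
  finally show False using r0 by simp
qed

subsection \<open>The root bound under differentiation\<close>

lemma size_ge_2_imp_add_mset:
  assumes "b \<in># B" "size B \<ge> 2"
  obtains B' where "B = add_mset b B'" "B' \<noteq> {#}"
  using assms by (metis One_nat_def Suc_1 le_numeral_extra(4) mset_add not_less_eq_eq size_add_mset size_empty zero_le_one)

text \<open>
  The root bound \<open>\<theta>\<close> drops by \<open>\<theta> / c\<close>, which is the Newton step of \<open>root_poly B\<close> at \<open>\<theta>\<close> when the
  bound on the sum is attained. Chebyshev's sum inequality gives the bound at the new point.
\<close>

lemma pderiv_root_poly_bound:
  fixes B :: "real multiset"
  assumes "size B = Suc n" "n > 0" "\<theta> > 0" "c > real (Suc n)"
    and B: "\<And>b. b \<in># B \<Longrightarrow> 0 \<le> b \<and> b < \<theta>"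
    and sum: "(\<Sum>b\<in>#B. \<theta> / (\<theta> - b)) \<le> c"
    and x: "x = \<theta> * (c - 1) / c"
  obtains C where "smult (1 / real (Suc n)) (pderiv (root_poly B)) = root_poly C" "size C = n"
    "\<And>b. b \<in># C \<Longrightarrow> 0 \<le> b \<and> b < x" "(\<Sum>b\<in>#C. x / (x - b)) \<le> c - 1"
proof -
  define f where "f = smult (1 / real (Suc n)) (pderiv (root_poly B))"
  define C where "C = proots f"
  have "c > 1" using assms by simp
  have x\<theta>: "\<theta> - x = \<theta> / c" using \<open>c > 1\<close> by (simp add: x field_simps)
  then have "x < \<theta>" using \<open>c > 1\<close> \<open>\<theta> > 0\<close> by (metis diff_gt_0_iff_gt divide_pos_pos less_trans zero_less_one)
  have "B \<noteq> {#}" using assms by auto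
  have deg: "degree f = n" using assms by (simp add: f_def degree_pderiv)
  then have lead: "lead_coeff f = 1"
    using assms lead_coeff_root_poly[of B] by (simp add: f_def coeff_pderiv)
  have "nonneg_rooted (pderiv (root_poly B))"
    using B \<open>B \<noteq> {#}\<close> by (intro nonneg_rooted_pderiv_root_poly) auto
  moreover have "map_poly complex_of_real f = smult (complex_of_real (1 / real (Suc n))) (map_poly complex_of_real (pderiv (root_poly B)))"
    by (rule poly_eqI) (simp add: f_def coeff_map_poly)
  ultimately have "nonneg_rooted f"
    by (auto simp: nonneg_rooted_def simp del: of_nat_Suc)
  then have C: "f = root_poly C" "\<And>b. b \<in># C \<Longrightarrow> 0 \<le> b"
    using nonneg_rooted_imp_root_poly[OF lead] by (auto simp: C_def)
  \<comment> \<open>\<open>n > 0\<close> leaves another, positive term, so the term of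
    \<open>b\<close> alone is below \<open>c\<close>; and \<theta> / (\<theta> - b) < c means b <
    x.\<close>
  have Bx: "b < x" if b: "b \<in># B" for b
  proof -
    obtain B' where B': "B = add_mset b B'" "B' \<noteq> {#}"
      by (rule size_ge_2_imp_add_mset[OF b]) (use assms in auto)
    have "(\<Sum>b\<in>#B'. \<theta> / (\<theta> - b)) > 0"
      using B' B \<open>\<theta> > 0\<close> by (intro sum_mset_pos) auto
    then have "\<theta> / (\<theta> - b) < c" using sum B' by simp
    then have "\<theta> / c < \<theta> - b" using B[OF b] \<open>c > 1\<close> \<open>\<theta> > 0\<close> by (simp add: field_simps)
    then show ?thesis using x\<theta> by simp
  qed
  have pos: "poly f u > 0" if "u \<ge> x" for u
  proof -
    have u: "b < u" if "b \<in># B" for b using Bx[OF that] \<open>u \<ge> x\<close> by simp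
    have "(\<Sum>b\<in>#B. 1 / (u - b)) > 0" using u \<open>B \<noteq> {#}\<close> by (intro sum_mset_pos) auto
    moreover have "poly (root_poly B) u > 0" using u by (rule poly_root_poly_pos)
    moreover have "u \<notin># B" using u by blast
    ultimately show ?thesis by (simp add: f_def poly_pderiv_root_poly)
  qed
  have Cx: "b < x" if "b \<in># C" for b
    using pos[of b] that poly_root_poly_eq_0_iff[of C b] C by force
  have xB: "x \<notin># B" and xC: "x \<notin># C" using Bx Cx by blast+
  define S where "S = (\<Sum>b\<in>#B. 1 / (x - b))"
  define T where "T = (\<Sum>b\<in>#B. (1 / (x - b))\<^sup>2)"
  define G where "G = (\<Sum>b\<in>#B. 1 / (\<theta> - b))"
  define W where "W = (\<Sum>b\<in>#B. 1 / (x - b) * (1 / (\<theta> - b)))"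
  have "S > 0" unfolding S_def using Bx \<open>B \<noteq> {#}\<close> by (intro sum_mset_pos) auto
  have "T > 0" unfolding T_def using Bx \<open>B \<noteq> {#}\<close> by (intro sum_mset_pos) (auto simp: less_imp_neq)
  have "poly (root_poly B) x > 0" using Bx by (rule poly_root_poly_pos)
  \<comment> \<open>The logarithmic derivative of \<open>f\<close> at \<open>x\<close> is computed
    twice, from the roots \<open>B\<close> and from the roots \<open>C\<close>.\<close>
  then have "poly (pderiv f) x / poly f x = (S\<^sup>2 - T) / S"
    by (simp add: f_def pderiv_smult poly_pderiv_root_poly[OF xB] poly_pderiv2_root_poly[OF xB] S_def T_def del: of_nat_Suc)
  moreover have "poly (pderiv f) x / poly f x = (\<Sum>b\<in>#C. 1 / (x - b))"
    using pos[of x] poly_pderiv_root_poly[OF xC] C(1) by simp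
  ultimately have ratio: "(\<Sum>b\<in>#C. 1 / (x - b)) = (S\<^sup>2 - T) / S" by simp
  \<comment> \<open>For b < x the value 1 / (x - b) increases in b, while (x - b) / (\<theta> - b)
    decreases because x < \<theta>.\<close>
  have cheb: "W * S \<le> G * T"
    unfolding W_def S_def G_def T_def
  proof (rule sum_mset_le_times_sum_mset)
    fix a b assume ab: "a \<in># B" "b \<in># B"
    have p: "x - a > 0" "x - b > 0" "\<theta> - a > 0" "\<theta> - b > 0" using ab Bx B by auto
    have 1: "1 / (x - b) - 1 / (x - a) = (b - a) / ((x - a) * (x - b))"
      using p by (simp add: field_simps)
    have 2: "1 / (\<theta> - a) * (1 / (x - b)) - 1 / (\<theta> - b) * (1 / (x - a)) =
        (\<theta> - x) * (b - a) / ((\<theta> - a) * (\<theta> - b) * (x - a) * (x - b))"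
    proof -
      have "1 / s * (1 / v) - 1 / t * (1 / u) = (t * u - s * v) / (s * t * u * v)"
        if "s > 0" "t > 0" "u > 0" "v > 0" for s t u v :: real
        using that by (simp add: field_simps)
      from this[of "\<theta> - a" "\<theta> - b" "x - a" "x - b"] p
      have "1 / (\<theta> - a) * (1 / (x - b)) - 1 / (\<theta> - b) * (1 / (x - a)) =
        ((\<theta> - b) * (x - a) - (\<theta> - a) * (x - b)) / ((\<theta> - a) * (\<theta> - b) * (x - a) * (x - b))"
        by simp
      also have "(\<theta> - b) * (x - a) - (\<theta> - a) * (x - b) = (\<theta> - x) * (b - a)"
        by (simp add: algebra_simps)
      finally show ?thesis .
    qed
    have "(1 / (x - b) - 1 / (x - a)) * (1 / (\<theta> - a) * (1 / (x - b)) - 1 / (\<theta> - b) * (1 / (x - a))) =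
      (\<theta> - x) * (b - a)\<^sup>2 / ((x - a) * (x - b) * ((\<theta> - a) * (\<theta> - b) * (x - a) * (x - b)))"
      unfolding 1 2 by (simp add: power2_eq_square)
    also have "\<dots> \<ge> 0" using p \<open>x < \<theta>\<close> by simp
    finally show "0 \<le> (1 / (x - b) - 1 / (x - a)) * (1 / (\<theta> - a) * (1 / (x - b)) - 1 / (\<theta> - b) * (1 / (x - a)))" .
  qed
  have "\<theta> * G \<le> c" using sum by (simp add: G_def sum_mset_distrib_left)
  then have G: "\<theta> / c * G \<le> 1" "G \<le> c / \<theta>" using \<open>c > 1\<close> \<open>\<theta> > 0\<close> by (simp_all add: field_simps)
  \<comment> \<open>A resolvent identity: with \<theta> - x = \<theta> / c it relates the sums at
    \<open>x\<close> and at \<theta>.\<close>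
  have inv_eq: "1 / u = 1 / v + (v - u) * (1 / u * (1 / v))" if "u > 0" "v > 0" for u v :: real
    using that by (simp add: field_simps)
  have "S = (\<Sum>b\<in>#B. 1 / (\<theta> - b) + \<theta> / c * (1 / (x - b) * (1 / (\<theta> - b))))"
    unfolding S_def
  proof (intro arg_cong[of _ _ sum_mset] image_mset_cong)
    fix b assume b: "b \<in># B"
    then have "x - b > 0" "\<theta> - b > 0" using Bx B by auto
    then show "1 / (x - b) = 1 / (\<theta> - b) + \<theta> / c * (1 / (x - b) * (1 / (\<theta> - b)))"
      using inv_eq[of "x - b" "\<theta> - b"] unfolding x\<theta>[symmetric] diff_diff_eq2 by (simp only: diff_add_cancel)
  qed
  then have SG: "S = G + \<theta> / c * W"
    by (simp add: G_def W_def sum_mset.distrib sum_mset_distrib_left)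
  \<comment> \<open>Only one factor \<open>S\<close> is expanded, so that \<open>cheb\<close>
    applies to \<open>W * S\<close>. The outcome bounds the sum over \<open>C\<close> by c /
    \<theta>, and x c / \<theta> = c - 1.\<close>
  have "S\<^sup>2 = G * S + \<theta> / c * (W * S)"
    by (subst power2_eq_square, subst SG) (simp add: algebra_simps)
  also have "\<dots> \<le> c / \<theta> * S + \<theta> / c * (G * T)"
    using G cheb \<open>S > 0\<close> \<open>c > 1\<close> \<open>\<theta> > 0\<close> by (intro add_mono mult_left_mono mult_right_mono) auto
  also have "\<dots> \<le> c / \<theta> * S + T"
    using mult_right_mono[OF G(1), of T] \<open>T > 0\<close> by (simp add: mult.assoc)
  finally have "(S\<^sup>2 - T) / S \<le> c / \<theta>" using \<open>S > 0\<close> by (simp add: field_simps)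
  moreover have "x > 0" using x \<open>c > 1\<close> \<open>\<theta> > 0\<close> by simp
  ultimately have "x * ((S\<^sup>2 - T) / S) \<le> x * (c / \<theta>)" by (intro mult_left_mono) auto
  also have "x * (c / \<theta>) = c - 1" using x \<open>c > 1\<close> \<open>\<theta> > 0\<close> by simp
  finally have "(\<Sum>b\<in>#C. x / (x - b)) \<le> c - 1"
    unfolding ratio[symmetric] by (simp add: sum_mset_distrib_left)
  moreover have "size C = n" using deg C(1) by simp
  ultimately show thesis using that[of C] C Cx by (auto simp: f_def)
qed

text \<open>Terms with b > 0 decrease strictly in u. If all roots are 0, the sum is constantly
  \<open>size B\<close>, and the strict bound on \<open>c\<close> takes over.\<close>

lemma sum_mset_divide_less:
  fixes B :: "real multiset"
  assumes "\<theta> > 0" "u > \<theta>" "c > real (size B)"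
    and B: "\<And>b. b \<in># B \<Longrightarrow> 0 \<le> b \<and> b < \<theta>"
    and sum: "(\<Sum>b\<in>#B. \<theta> / (\<theta> - b)) \<le> c"
  shows "(\<Sum>b\<in>#B. u / (u - b)) < c"
proof (cases "\<exists>b\<in>#B. b > 0")
  case True
  then obtain b B' where b: "B = add_mset b B'" "b > 0" by (metis mset_add)
  have le: "u / (u - a) \<le> \<theta> / (\<theta> - a)" if "a \<in># B" for a
    using B[OF that] assms mult_left_mono[of \<theta> u a] by (simp add: field_simps)
  have "(\<Sum>b\<in>#B'. u / (u - b)) \<le> (\<Sum>b\<in>#B'. \<theta> / (\<theta> - b))"
    using le b by (intro sum_mset_mono) auto
  moreover have "u / (u - b) < \<theta> / (\<theta> - b)" 
  proof -
    have "0 < \<theta> - b" "0 < u - b" "\<theta> * b < u * b" using B[of b] assms(1,2) b by auto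
    then show ?thesis by (simp add: divide_less_eq less_divide_eq algebra_simps)
  qed
  ultimately show ?thesis using sum b by simp
next
  case False
  then have zero: "b = 0" if "b \<in># B" for b using B that by force
  have "image_mset (\<lambda>b. u / (u - b)) B = image_mset (\<lambda>_. 1) B"
    using assms(1,2) by (intro image_mset_cong) (auto dest!: zero)
  then show ?thesis using assms by simp
qed

text \<open>The binomials in (x - \<mu>)^d cancel those in the convolution, leaving a rescaling of
  the variable.\<close>

lemma sym_mult_conv_replicate_root:
  assumes "degree q \<le> d" "\<mu> \<noteq> 0"
  shows "sym_mult_conv d (root_poly (replicate_mset d \<mu>)) q = smult (\<mu> ^ d) (pcompose q [:0, 1 / \<mu>:])"
proof (rule poly_eqI)
  fix k
  have 1: "root_poly (replicate_mset d \<mu>) = [:- \<mu>, 1:] ^ d"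
    by (simp add: root_poly_def)
  have 2: "(-1) ^ (d - k) * (real (d choose k) * (- \<mu>) ^ (d - k)) = real (d choose k) * (\<mu> ^ d / \<mu> ^ k)"
    if "k \<le> d"
  proof -
    have "(-1) ^ (d - k) * (- \<mu>) ^ (d - k) = \<mu> ^ (d - k)" by (simp flip: power_mult_distrib)
    also have "\<dots> = \<mu> ^ d / \<mu> ^ k" using that assms by (simp add: power_diff)
    finally show ?thesis by (simp only: mult.left_commute)
  qed
  show "coeff (sym_mult_conv d (root_poly (replicate_mset d \<mu>)) q) k =
      coeff (smult (\<mu> ^ d) (pcompose q [:0, 1 / \<mu>:])) k"
  proof (cases "k \<le> d")
    case True
    then show ?thesis
      using 2 by (simp add: coeff_sym_mult_conv 1 coeff_linear_poly_power coeff_pcompose_linear power_divide del: mult_minus1)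
  next
    case False
    then show ?thesis
      using assms by (simp add: coeff_sym_mult_conv coeff_pcompose_linear coeff_eq_0)
  qed
qed

lemma sum_mset_eq_0_ex_neg_pos:
  fixes f :: "'a \<Rightarrow> real"
  assumes "(\<Sum>x\<in>#A. f x) = 0" "a \<in># A" "f a \<noteq> 0"
  shows "(\<exists>x\<in>#A. f x < 0) \<and> (\<exists>x\<in>#A. f x > 0)"
proof -
  obtain A' where A: "A = add_mset a A'" using assms by (metis mset_add)
  have "\<exists>x\<in>#A. g x < 0" if g: "(\<Sum>x\<in>#A. g x) = 0" "g a \<noteq> 0" for g :: "'a \<Rightarrow> real"
  proof (rule ccontr)
    assume "\<not> ?thesis"
    then have nn: "\<And>x. x \<in># A \<Longrightarrow> g x \<ge> 0" by force
    have "(\<Sum>x\<in>#A'. 0) \<le> (\<Sum>x\<in>#A'. g x)" using nn A by (intro sum_mset_mono) auto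
    then show False using g nn[of a] A by simp
  qed
  moreover have neg: "(\<Sum>x\<in>#A. - f x) = - (\<Sum>x\<in>#A. f x)" by (induction A) auto
  ultimately show ?thesis using assms by force
qed

subsection \<open>The convolution bound\<close>

definition euler_op :: "real \<Rightarrow> real poly \<Rightarrow> real \<Rightarrow> real" where
  "euler_op c r z = c * poly r z - z * poly (pderiv r) z"

text \<open>The operator multiplies x^k by c - k. A factor x raises every exponent by one, whence
  the shift to \<open>c - 1\<close>.\<close>

lemma euler_op_add: "euler_op c (r + s) z = euler_op c r z + euler_op c s z"
  and euler_op_smult: "euler_op c (smult k r) z = k * euler_op c r z"
  and euler_op_times_x: "euler_op c ([:0, 1:] * r) z = z * euler_op (c - 1) r z"
  by (simp_all add: euler_op_def pderiv_add pderiv_smult pderiv_mult pderiv_pCons algebra_simps)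

text \<open>Factoring out \<open>root_poly B\<close> leaves c minus the sum of u / (u - b). This
  settles the case in which all roots of the other polynomial agree.\<close>

lemma euler_op_root_poly_pos:
  assumes "\<theta> > 0" "u > \<theta>" "c > real (size B)"
    and B: "\<And>b. b \<in># B \<Longrightarrow> 0 \<le> b \<and> b < \<theta>"
    and sum: "(\<Sum>b\<in>#B. \<theta> / (\<theta> - b)) \<le> c"
  shows "0 < euler_op c (root_poly B) u"
proof -
  have u: "b < u" if "b \<in># B" for b using B[OF that] assms by simp
  then have "u \<notin># B" by blast
  then have "euler_op c (root_poly B) u = poly (root_poly B) u * (c - (\<Sum>b\<in>#B. u / (u - b)))"
    by (simp add: euler_op_def poly_pderiv_root_poly sum_mset_distrib_left algebra_simps)
  moreover have "poly (root_poly B) u > 0" using u by (rule poly_root_poly_pos)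
  ultimately show ?thesis using sum_mset_divide_less[OF assms] by simp
qed

text \<open>
  In the coordinates \<open>t = y / (y - a)\<close>, a quadratic with prescribed \<open>t\<^sub>1 + t\<^sub>2\<close> depends affinely on
  \<open>1 / (t\<^sub>1 t\<^sub>2)\<close>. It is therefore a convex combination of a quadratic whose \<open>t\<close>-values are closer
  together and of the extreme one, in which \<open>t = 1\<close> gives the root \<open>0\<close>.
\<close>

lemma quadratic_convex_combination:
  fixes t\<^sub>1 t\<^sub>2 e y :: real
  assumes "1 \<le> t\<^sub>1" "t\<^sub>1 < e" "e < t\<^sub>2"
  obtains k where "0 \<le> k" "k \<le> 1"
    "[:- (y * (1 - 1 / t\<^sub>1)), 1:] * [:- (y * (1 - 1 / t\<^sub>2)), 1:] =
      smult k ([:- (y * (1 - 1 / e)), 1:] * [:- (y * (1 - 1 / (t\<^sub>1 + t\<^sub>2 - e))), 1:]) +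
      smult (1 - k) ([:0, 1:] * [:- (y * (1 - 1 / (t\<^sub>1 + t\<^sub>2 - 1))), 1:])"
proof -
  define s where "s = t\<^sub>1 + t\<^sub>2"
  define f where "f = 1 / (t\<^sub>1 * t\<^sub>2)"
  define g where "g = 1 / (e * (s - e))"
  define h where "h = 1 / (s - 1)"
  define k where "k = (h - f) / (h - g)"
  have "0 < e - t\<^sub>1" "0 < t\<^sub>2 - e" using assms by auto
  then have "0 < (e - t\<^sub>1) * (t\<^sub>2 - e)" by simp
  then have "t\<^sub>1 * t\<^sub>2 < e * (s - e)" by (simp add: s_def algebra_simps)
  moreover have "0 \<le> (t\<^sub>1 - 1) * (t\<^sub>2 - 1)" using assms by simp
  then have "s - 1 \<le> t\<^sub>1 * t\<^sub>2" by (simp add: s_def algebra_simps)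
  moreover have "s - 1 > 0" using assms by (simp add: s_def)
  ultimately have "g < f" "f \<le> h" unfolding g_def f_def h_def
    by (auto intro!: divide_strict_left_mono divide_left_mono)
  then have k: "0 \<le> k" "k \<le> 1" by (auto simp: k_def field_simps)
  have "k * (h - g) = h - f" using \<open>g < f\<close> \<open>f \<le> h\<close> by (simp add: k_def)
  then have f: "f = k * g + (1 - k) * h" by (simp add: algebra_simps)
  have prod: "[:- (y * (1 - 1 / a)), 1:] * [:- (y * (1 - 1 / b)), 1:] =
      [:y\<^sup>2 * (1 - (a + b) * (1 / (a * b)) + 1 / (a * b)), - y * (2 - (a + b) * (1 / (a * b))), 1:]"
    if "a > 0" "b > 0" for a b
    using that by (simp add: field_simps power2_eq_square)
  have 1: "[:- (y * (1 - 1 / t\<^sub>1)), 1:] * [:- (y * (1 - 1 / t\<^sub>2)), 1:] =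
      [:y\<^sup>2 * (1 - s * f + f), - y * (2 - s * f), 1:]"
    using prod[of t\<^sub>1 t\<^sub>2] assms by (simp add: s_def f_def)
  have 2: "[:- (y * (1 - 1 / e)), 1:] * [:- (y * (1 - 1 / (s - e))), 1:] =
      [:y\<^sup>2 * (1 - s * g + g), - y * (2 - s * g), 1:]"
    using prod[of e "s - e"] assms by (simp add: s_def g_def)
  have 3: "[:0, 1:] * [:- (y * (1 - 1 / (s - 1))), 1:] =
      [:y\<^sup>2 * (1 - s * h + h), - y * (2 - s * h), 1:]"
    using prod[of 1 "s - 1"] assms by (simp add: s_def h_def)
  show thesis
  proof (rule that[OF k], fold s_def)
    show "[:- (y * (1 - 1 / t\<^sub>1)), 1:] * [:- (y * (1 - 1 / t\<^sub>2)), 1:] =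
      smult k ([:- (y * (1 - 1 / e)), 1:] * [:- (y * (1 - 1 / (s - e))), 1:]) +
      smult (1 - k) ([:0, 1:] * [:- (y * (1 - 1 / (s - 1))), 1:])"
      unfolding 1 2 3 unfolding f by (simp add: algebra_simps)
  qed
qed

text \<open>Induction on the degree, with \<open>y\<close> and \<open>z\<close> fixed while
  \<open>c\<close> and \<theta> move. The sum over \<open>A\<close> is kept exact by the exchanges;
  for \<open>B\<close> an inequality is what the Newton step preserves.\<close>

lemma euler_op_sym_mult_conv_pos:
  fixes A B :: "real multiset"
  assumes "size A = d" "size B = d" "c > real d" "y > 0" "\<theta> > 0"
    and "\<And>a. a \<in># A \<Longrightarrow> 0 \<le> a \<and> a < y" "\<And>b. b \<in># B \<Longrightarrow> 0 \<le> b \<and> b < \<theta>"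
    and "(\<Sum>a\<in>#A. y / (y - a)) = c" "(\<Sum>b\<in>#B. \<theta> / (\<theta> - b)) \<le> c"
    and "z > (c - real d) / c * y * \<theta>"
  shows "0 < euler_op c (sym_mult_conv d (root_poly A) (root_poly B)) z"
  using assms
proof (induction d arbitrary: A B c \<theta>)
  case 0
  then show ?case by simp
next
  case (Suc n)
  have "c > 1" using Suc.prems by simp
  have z: "z > 0"
    using Suc.prems \<open>c > 1\<close> by (smt (verit) divide_pos_pos mult_pos_pos)
  have zero_root: "0 < euler_op c (sym_mult_conv (Suc n) (root_poly (add_mset 0 F)) (root_poly B)) z"
    if F: "size F = n" "\<And>a. a \<in># F \<Longrightarrow> 0 \<le> a \<and> a < y" "(\<Sum>a\<in>#F. y / (y - a)) = c - 1" for F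
  proof -
    define x where "x = \<theta> * (c - 1) / c"
    have "n > 0" using F(1,3) \<open>c > 1\<close> by (cases "F = {#}") (auto simp: nonempty_has_size)
    obtain C where C: "smult (1 / real (Suc n)) (pderiv (root_poly B)) = root_poly C" "size C = n"
      "\<And>b. b \<in># C \<Longrightarrow> 0 \<le> b \<and> b < x" "(\<Sum>b\<in>#C. x / (x - b)) \<le> c - 1"
      using pderiv_root_poly_bound[OF Suc.prems(2) \<open>n > 0\<close> Suc.prems(5,3,7,9) x_def] by blast
    have "0 < euler_op (c - 1) (sym_mult_conv n (root_poly F) (root_poly C)) z"
    proof (rule Suc.IH[of F C "c - 1" x])
      show "0 < x" using \<open>c > 1\<close> Suc.prems by (simp add: x_def)
      \<comment> \<open>The threshold for \<open>z\<close> is invariant under the step to degree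
        \<open>n\<close>.\<close>
      have "(c - 1 - real n) / (c - 1) * y * x = (c - real (Suc n)) / c * y * \<theta>"
        using \<open>c > 1\<close> by (simp add: x_def)
      then show "(c - 1 - real n) / (c - 1) * y * x < z" using Suc.prems by simp
    qed (use Suc.prems F C in auto)
    then have "0 < z * euler_op (c - 1) (sym_mult_conv n (root_poly F) (root_poly C)) z"
      using z by simp
    then show ?thesis
      unfolding root_poly_add C(1)[symmetric] euler_op_times_x[symmetric] sym_mult_conv_pCons_0[symmetric]
      by simp
  qed
  \<comment> \<open>\<open>e\<close> is the mean of the values y / (y - a). The inner induction is
    on \<open>N\<close>, the number of roots whose value differs from \<open>e\<close>.\<close>
  define e where "e = c / real (Suc n)"
  have "e > 1" using Suc.prems by (simp add: e_def)
  define N where "N A = size (filter_mset (\<lambda>a. y / (y - a) \<noteq> e) A)" for A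
  have "size A = Suc n \<Longrightarrow> (\<And>a. a \<in># A \<Longrightarrow> 0 \<le> a \<and> a < y) \<Longrightarrow> (\<Sum>a\<in>#A. y / (y - a)) = c \<Longrightarrow>
      0 < euler_op c (sym_mult_conv (Suc n) (root_poly A) (root_poly B)) z" for A
  proof (induction "N A" arbitrary: A rule: less_induct)
    case less
    have a_of_t: "a = y * (1 - 1 / (y / (y - a)))" if "a \<in># A" for a
      using less.prems(2)[OF that] \<open>y > 0\<close> by (simp add: field_simps)
    have y_of_t: "y / (y - y * (1 - 1 / t)) = t" "0 \<le> y * (1 - 1 / t)" "y * (1 - 1 / t) < y"
      if "t \<ge> 1" for t
      using \<open>y > 0\<close> that by (auto simp: field_simps)
    show ?case
    proof (cases "\<exists>a\<in>#A. y / (y - a) \<noteq> e")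
      case False
      define \<mu> where "\<mu> = y * (1 - 1 / e)"
      have "\<mu> > 0" using \<open>e > 1\<close> \<open>y > 0\<close> by (simp add: \<mu>_def)
      have "a = \<mu>" if "a \<in># A" for a using a_of_t[OF that] False that by (auto simp: \<mu>_def)
      then have A: "A = replicate_mset (Suc n) \<mu>"
        using less.prems(1) by (metis set_mset_subset_singletonD singletonI subsetI)
      \<comment> \<open>The threshold is thus \<mu> \<theta>, and rescaling by \<mu> leaves an
        evaluation of \<open>root_poly B\<close> beyond \<theta>.\<close>
      have \<mu>: "\<mu> = (c - real (Suc n)) / c * y"
        using \<open>c > 1\<close> by (simp add: \<mu>_def e_def field_simps)
      then have "z > \<mu> * \<theta>" using Suc.prems by simp
      then have "z / \<mu> > \<theta>" using \<open>\<mu> > 0\<close> by (simp add: field_simps)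
      then have "0 < euler_op c (root_poly B) (z / \<mu>)"
        using Suc.prems by (intro euler_op_root_poly_pos[of \<theta>]) auto
      moreover have "euler_op c (sym_mult_conv (Suc n) (root_poly A) (root_poly B)) z =
          \<mu> ^ Suc n * euler_op c (root_poly B) (z / \<mu>)"
        unfolding A using Suc.prems \<open>\<mu> > 0\<close>
        by (subst sym_mult_conv_replicate_root)
           (auto simp: euler_op_smult, simp add: euler_op_def poly_pcompose pderiv_pcompose pderiv_pCons)
      ultimately show ?thesis using \<open>\<mu> > 0\<close> by simp
    next
      case True
      then obtain a where a: "a \<in># A" "y / (y - a) - e \<noteq> 0" by auto
      have "(\<Sum>a\<in>#M. y / (y - a) - e) = (\<Sum>a\<in>#M. y / (y - a)) - real (size M) * e" for M
        by (induction M) (auto simp: algebra_simps)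
      then have "(\<Sum>a\<in>#A. y / (y - a) - e) = 0"
        using less.prems by (simp add: e_def)
      from sum_mset_eq_0_ex_neg_pos[OF this a]
      obtain a\<^sub>1 a\<^sub>2 where a12: "a\<^sub>1 \<in># A" "a\<^sub>2 \<in># A" "y / (y - a\<^sub>1) < e" "e < y / (y - a\<^sub>2)"
        by auto
      then have "a\<^sub>1 \<noteq> a\<^sub>2" by auto
      then obtain F where F: "A = add_mset a\<^sub>1 (add_mset a\<^sub>2 F)"
        using a12 by (metis insert_noteq_member mset_add)
      define t\<^sub>1 t\<^sub>2 where "t\<^sub>1 = y / (y - a\<^sub>1)" and "t\<^sub>2 = y / (y - a\<^sub>2)"
      have t: "t\<^sub>1 < e" "e < t\<^sub>2" using a12 by (auto simp: t\<^sub>1_def t\<^sub>2_def)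
      have "1 \<le> t\<^sub>1" using less.prems(2)[OF a12(1)] by (simp add: t\<^sub>1_def field_simps)
      have at: "a\<^sub>1 = y * (1 - 1 / t\<^sub>1)" "a\<^sub>2 = y * (1 - 1 / t\<^sub>2)"
        unfolding t\<^sub>1_def t\<^sub>2_def using a_of_t a12 by blast+
      obtain k where k: "0 \<le> k" "k \<le> 1" "[:- a\<^sub>1, 1:] * [:- a\<^sub>2, 1:] =
          smult k ([:- (y * (1 - 1 / e)), 1:] * [:- (y * (1 - 1 / (t\<^sub>1 + t\<^sub>2 - e))), 1:]) +
          smult (1 - k) ([:0, 1:] * [:- (y * (1 - 1 / (t\<^sub>1 + t\<^sub>2 - 1))), 1:])"
        unfolding at using quadratic_convex_combination[OF \<open>1 \<le> t\<^sub>1\<close> t] by blast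
      define A\<^sub>1 where "A\<^sub>1 = add_mset (y * (1 - 1 / e)) (add_mset (y * (1 - 1 / (t\<^sub>1 + t\<^sub>2 - e))) F)"
      define F\<^sub>2 where "F\<^sub>2 = add_mset (y * (1 - 1 / (t\<^sub>1 + t\<^sub>2 - 1))) F"
      have "root_poly A = ([:- a\<^sub>1, 1:] * [:- a\<^sub>2, 1:]) * root_poly F"
        unfolding F root_poly_add by (simp only: mult.assoc)
      also have "\<dots> = smult k (root_poly A\<^sub>1) + smult (1 - k) (root_poly (add_mset 0 F\<^sub>2))"
        unfolding k(3) A\<^sub>1_def F\<^sub>2_def root_poly_add distrib_right
        by (simp only: mult_smult_left mult.assoc minus_zero)
      finally have eq: "euler_op c (sym_mult_conv (Suc n) (root_poly A) (root_poly B)) z =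
          k * euler_op c (sym_mult_conv (Suc n) (root_poly A\<^sub>1) (root_poly B)) z +
          (1 - k) * euler_op c (sym_mult_conv (Suc n) (root_poly (add_mset 0 F\<^sub>2)) (root_poly B)) z"
        by (simp only: sym_mult_conv_add_left sym_mult_conv_smult_left euler_op_add euler_op_smult)
      have sumF: "(\<Sum>a\<in>#F. y / (y - a)) = c - t\<^sub>1 - t\<^sub>2"
        using less.prems(3) by (simp add: F t\<^sub>1_def t\<^sub>2_def)
      \<comment> \<open>Values at least 1 correspond to roots in [0, y); the second bound combines
        \<open>1 \<le> t\<^sub>1\<close> with \<open>e < t\<^sub>2\<close>.\<close>
      have ge: "1 \<le> e" "1 \<le> t\<^sub>1 + t\<^sub>2 - e" "1 \<le> t\<^sub>1 + t\<^sub>2 - 1"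
        using \<open>e > 1\<close> t \<open>1 \<le> t\<^sub>1\<close> by auto
      have "0 < euler_op c (sym_mult_conv (Suc n) (root_poly A\<^sub>1) (root_poly B)) z"
      proof (rule less.hyps)
        \<comment> \<open>Both removed roots are counted by \<open>N A\<close>, whereas the new root
          with value \<open>e\<close> is not.\<close>
        show "N A\<^sub>1 < N A"
          unfolding N_def A\<^sub>1_def F using a12 by (simp add: y_of_t[OF ge(1)])
        show "(\<Sum>a\<in>#A\<^sub>1. y / (y - a)) = c"
          by (simp add: A\<^sub>1_def sumF y_of_t[OF ge(1)] y_of_t[OF ge(2)])
        show "0 \<le> a \<and> a < y" if "a \<in># A\<^sub>1" for a
          using that y_of_t(2,3)[OF ge(1)] y_of_t(2,3)[OF ge(2)] less.prems(2)[of a]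
          by (auto simp only: A\<^sub>1_def F set_mset_add_mset_insert insert_iff)
      qed (use less.prems in \<open>auto simp: F A\<^sub>1_def\<close>)
      moreover have "0 < euler_op c (sym_mult_conv (Suc n) (root_poly (add_mset 0 F\<^sub>2)) (root_poly B)) z"
      proof (rule zero_root)
        show "(\<Sum>a\<in>#F\<^sub>2. y / (y - a)) = c - 1"
          by (simp add: F\<^sub>2_def sumF y_of_t[OF ge(3)])
        show "0 \<le> a \<and> a < y" if "a \<in># F\<^sub>2" for a
          using that y_of_t(2,3)[OF ge(3)] less.prems(2)[of a]
          by (auto simp only: F\<^sub>2_def F set_mset_add_mset_insert insert_iff)
      qed (use less.prems in \<open>auto simp: F F\<^sub>2_def\<close>)
      ultimately show ?thesis
        unfolding eq using k(1,2) by (cases "k = 0") (auto intro!: add_pos_nonneg)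
    qed
  qed
  then show ?case using Suc.prems by blast
qed

subsection \<open>Transforms\<close>

lemma is_M_preimage_root_poly_iff:
  assumes "A \<noteq> {#}"
  shows "is_M_preimage (root_poly A) w z \<longleftrightarrow>
    z \<notin># A \<and> (\<Sum>a\<in>#A. z / (z - a)) = real (size A) * (1 + w)"
proof -
  have "z * (1 / real (size A) * (\<Sum>a\<in>#A. 1 / (z - a))) = (\<Sum>a\<in>#A. z / (z - a)) / real (size A)"
  proof -
    have "(\<Sum>a\<in>#A. z / (z - a)) = z * (\<Sum>a\<in>#A. 1 / (z - a))"
      by (simp add: sum_mset_distrib_left)
    then show ?thesis by simp
  qed
  then show ?thesis
    using assms by (auto simp: is_M_preimage_def M_transform_def cauchy_transform_def
      poly_root_poly_eq_0_iff field_simps)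
qed

text \<open>Multiplying the preimage equation by the value of \<open>root_poly A\<close> at
  \<open>z\<close> clears the poles.\<close>

lemma is_M_preimage_imp_euler_op_eq_0:
  assumes "A \<noteq> {#}" "is_M_preimage (root_poly A) w z"
  shows "euler_op (real (size A) * (1 + w)) (root_poly A) z = 0"
proof -
  have z: "z \<notin># A" and sum: "(\<Sum>a\<in>#A. z / (z - a)) = real (size A) * (1 + w)"
    using assms by (auto simp: is_M_preimage_root_poly_iff)
  have "z * (\<Sum>a\<in>#A. 1 / (z - a)) = real (size A) * (1 + w)"
    by (simp add: sum_mset_distrib_left flip: sum)
  then show ?thesis
    by (simp add: euler_op_def poly_pderiv_root_poly[OF z])
qed

text \<open>A nonzero value cannot come from the default branch, so it is the greatest
  preimage.\<close>

lemma is_M_preimage_M_inverse: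
  assumes "M_inverse p w \<noteq> 0"
  shows "is_M_preimage p w (M_inverse p w)"
  using assms unfolding M_inverse_def
  by (auto split: if_splits intro: GreatestI2_order)

text \<open>The intermediate value theorem gives a preimage beyond the largest root. All preimages
  are zeros of one nonzero polynomial, so a greatest exists, and it too lies beyond the
  roots.\<close>

lemma M_inverse_root_poly_pos:
  assumes "w > 0" and A: "\<And>a. a \<in># A \<Longrightarrow> 0 \<le> a" and "\<exists>a\<in>#A. a > 0"
  shows "is_M_preimage (root_poly A) w (M_inverse (root_poly A) w)"
    "\<And>a. a \<in># A \<Longrightarrow> a < M_inverse (root_poly A) w" "0 < M_inverse (root_poly A) w"
proof -
  have "A \<noteq> {#}" using assms by auto
  define d where "d = real (size A)"
  have "d \<ge> 1" using \<open>A \<noteq> {#}\<close> by (cases A) (auto simp: d_def)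
  define m where "m = Max (set_mset A)"
  have m: "m \<in># A" "\<And>a. a \<in># A \<Longrightarrow> a \<le> m" using \<open>A \<noteq> {#}\<close> by (auto simp: m_def)
  have "m > 0" using m assms by force
  \<comment> \<open>At \<open>z\<^sub>1\<close> the term of \<open>m\<close> alone equals d (1 + w)
    + 1; at \<open>z\<^sub>2\<close> it equals 1 + w and bounds every other term.\<close>
  define z\<^sub>1 where "z\<^sub>1 = m * (1 + 1 / (d * (1 + w)))"
  define z\<^sub>2 where "z\<^sub>2 = m * (1 + 1 / w)"
  define f where "f z = (\<Sum>a\<in>#A. z / (z - a))" for z
  have "d * (1 + w) > 0" using \<open>d \<ge> 1\<close> \<open>w > 0\<close> by simp
  have "1 * w \<le> d * (1 + w)" using \<open>d \<ge> 1\<close> \<open>w > 0\<close> by (intro mult_mono) auto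
  then have "z\<^sub>1 \<le> z\<^sub>2" unfolding z\<^sub>1_def z\<^sub>2_def using \<open>m > 0\<close> \<open>w > 0\<close> \<open>d * (1 + w) > 0\<close>
    by (intro mult_left_mono add_left_mono divide_left_mono) auto
  have "z\<^sub>1 > m" using \<open>m > 0\<close> \<open>d * (1 + w) > 0\<close> by (simp add: z\<^sub>1_def)
  have 1: "f z\<^sub>1 \<ge> d * (1 + w)"
  proof -
    obtain A' where A': "A = add_mset m A'" using m by (metis mset_add)
    have "(\<Sum>a\<in>#A'. z\<^sub>1 / (z\<^sub>1 - a)) \<ge> (\<Sum>a\<in>#A'. 0)"
      using m A' \<open>z\<^sub>1 > m\<close> \<open>m > 0\<close> by (intro sum_mset_mono) (force intro!: divide_nonneg_nonneg)
    moreover have "z\<^sub>1 / (z\<^sub>1 - m) = d * (1 + w) + 1"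
    proof -
      have "m * (1 + 1 / e) / (m * (1 + 1 / e) - m) = e + 1" if "e > 0" for e
        using that \<open>m > 0\<close> by (simp add: field_simps)
      from this[OF \<open>d * (1 + w) > 0\<close>] show ?thesis by (simp only: z\<^sub>1_def)
    qed
    ultimately show ?thesis by (simp add: f_def A')
  qed
  have 2: "f z\<^sub>2 \<le> d * (1 + w)"
  proof -
    have "z\<^sub>2 > m" using \<open>z\<^sub>1 > m\<close> \<open>z\<^sub>1 \<le> z\<^sub>2\<close> by simp
    have "f z\<^sub>2 \<le> (\<Sum>a\<in>#A. z\<^sub>2 / (z\<^sub>2 - m))"
      unfolding f_def using m \<open>z\<^sub>2 > m\<close> \<open>m > 0\<close>
      by (intro sum_mset_mono divide_left_mono) (auto intro!: mult_pos_pos dest: m(2))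
    also have "z\<^sub>2 / (z\<^sub>2 - m) = 1 + w" using \<open>m > 0\<close> \<open>w > 0\<close> by (simp add: z\<^sub>2_def field_simps)
    finally show ?thesis by (simp add: d_def)
  qed
  have "continuous_on {z\<^sub>1..z\<^sub>2} (\<lambda>z. \<Sum>a\<in>#B. z / (z - a))" if "B \<subseteq># A" for B
    using that
  proof (induction B)
    case (add b B)
    then have "b \<in># A" "B \<subseteq># A" by (auto dest: mset_subset_eq_insertD subset_mset.less_imp_le)
    then show ?case using add \<open>z\<^sub>1 > m\<close> m(2)[of b] by (auto intro!: continuous_intros)
  qed auto
  then have "continuous_on {z\<^sub>1..z\<^sub>2} f" by (auto simp: f_def[abs_def])
  from IVT2'[OF 2 1 \<open>z\<^sub>1 \<le> z\<^sub>2\<close> this] obtain x where x: "z\<^sub>1 \<le> x" "f x = d * (1 + w)" by auto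
  have xm: "x > m" using x \<open>z\<^sub>1 > m\<close> by simp
  then have x0: "is_M_preimage (root_poly A) w x"
    using x m(2)[of x] \<open>A \<noteq> {#}\<close> by (auto simp: is_M_preimage_root_poly_iff f_def d_def)
  define Z where "Z = {z. is_M_preimage (root_poly A) w z}"
  have "finite Z"
  proof -
    define q where "q = smult (d * (1 + w)) (root_poly A) - [:0, 1:] * pderiv (root_poly A)"
    \<comment> \<open>This coefficient is d w, hence nonzero.\<close>
    have "coeff q (size A) = d * (1 + w) - d"
      using \<open>A \<noteq> {#}\<close> lead_coeff_root_poly[of A]
      by (cases "size A") (auto simp: q_def coeff_pderiv d_def)
    then have "q \<noteq> 0" using \<open>d \<ge> 1\<close> \<open>w > 0\<close> by (auto simp: algebra_simps)
    then have "finite {z. poly q z = 0}" by (rule poly_roots_finite)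
    moreover have "Z \<subseteq> {z. poly q z = 0}"
      using is_M_preimage_imp_euler_op_eq_0[OF \<open>A \<noteq> {#}\<close>, of w]
      by (auto simp: Z_def q_def euler_op_def d_def)
    ultimately show ?thesis by (rule rev_finite_subset)
  qed
  moreover have "x \<in> Z" using x0 by (simp add: Z_def)
  ultimately have Max: "Max Z \<in> Z" "\<And>z. z \<in> Z \<Longrightarrow> z \<le> Max Z" by (auto intro: Max_in)
  then have "(GREATEST z. is_M_preimage (root_poly A) w z) = Max Z"
    by (intro Greatest_equality) (auto simp: Z_def)
  moreover have "\<exists>z. is_M_preimage (root_poly A) w z \<and> (\<forall>y. is_M_preimage (root_poly A) w y \<longrightarrow> y \<le> z)"
    using Max by (intro exI[of _ "Max Z"]) (auto simp: Z_def)
  ultimately have M: "M_inverse (root_poly A) w = Max Z" by (simp add: M_inverse_def)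
  show "is_M_preimage (root_poly A) w (M_inverse (root_poly A) w)" using M Max by (simp add: Z_def)
  have "M_inverse (root_poly A) w > m" using M Max(2)[OF \<open>x \<in> Z\<close>] xm by simp
  then show "\<And>a. a \<in># A \<Longrightarrow> a < M_inverse (root_poly A) w" "0 < M_inverse (root_poly A) w"
    using m(2) \<open>m > 0\<close> by force+
qed

text \<open>Away from 0 every z / (z - 0) is 1, so the transform misses w > 0 and
  \<open>M_inverse\<close> takes its default 0.\<close>

lemma S_transform_monom:
  assumes "w > 0"
  shows "S_transform (monom 1 d) w = 0"
proof -
  have "monom 1 d = root_poly (replicate_mset d (0::real))"
    by (simp add: root_poly_def monom_altdef)
  moreover have "\<not> is_M_preimage (root_poly (replicate_mset d 0)) w z" for z
  proof (cases "d = 0")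
    \<comment> \<open>In degree 0 the totalised division makes the transform constantly -1.\<close>
    case True
    then show ?thesis using assms by (auto simp: is_M_preimage_def M_transform_def cauchy_transform_def)
  next
    case False
    then show ?thesis using assms by (auto simp: is_M_preimage_root_poly_iff)
  qed
  ultimately show ?thesis by (simp add: S_transform_def M_inverse_def)
qed

lemma sym_mult_conv_commute: "sym_mult_conv d p q = sym_mult_conv d q p"
  by (rule poly_eqI) (simp add: coeff_sym_mult_conv)

lemma sym_mult_conv_monom:
  assumes "coeff q d = 1"
  shows "sym_mult_conv d (monom 1 d) q = monom 1 d"
  by (rule poly_eqI) (use assms in \<open>auto simp: coeff_sym_mult_conv\<close>)

lemma root_poly_eq_monom:
  assumes "\<And>a. a \<in># A \<Longrightarrow> 0 \<le> a" "\<not> (\<exists>a\<in>#A. a > (0::real))"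
  shows "root_poly A = monom 1 (size A)"
proof -
  have "A = replicate_mset (size A) 0"
    using assms by (intro set_mset_subset_singletonD) force
  then show ?thesis by (metis (no_types, lifting) image_replicate_mset minus_zero monom_altdef prod_mset_replicate_mset root_poly_def smult_1_left)
qed

theorem theorem1p9:
  fixes p q :: "real poly" and d :: nat and w :: real
  assumes "lead_coeff p = 1" and "degree p = d" and "nonneg_rooted p"
    and "lead_coeff q = 1" and "degree q = d" and "nonneg_rooted q"
    and "w > 0"
  shows "S_transform (sym_mult_conv d p q) w \<le> S_transform p w * S_transform q w"
proof -
  define A where "A = proots p"
  define B where "B = proots q"
  define r where "r = sym_mult_conv d p q"
  define R where "R = proots r"
  have A: "p = root_poly A" "\<And>a. a \<in># A \<Longrightarrow> 0 \<le> a"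
    using nonneg_rooted_imp_root_poly[of p] assms by (auto simp: A_def)
  have B: "q = root_poly B" "\<And>b. b \<in># B \<Longrightarrow> 0 \<le> b"
    using nonneg_rooted_imp_root_poly[of q] assms by (auto simp: B_def)
  have r: "degree r = d" "lead_coeff r = 1"
    unfolding r_def using assms by (intro sym_mult_conv_monic; simp)+
  have "nonneg_rooted r" unfolding r_def using assms by (intro nonneg_rooted_sym_mult_conv)
  then have R: "r = root_poly R" using nonneg_rooted_imp_root_poly[of r] r by (simp add: R_def)
  have sz: "size A = d" "size B = d" "size R = d" using assms r A(1) B(1) R by auto
  show ?thesis
  proof (cases "(\<exists>a\<in>#A. a > 0) \<and> (\<exists>b\<in>#B. b > 0)")
    \<comment> \<open>One factor is x^d, hence so is the convolution, and both sides are 0.\<close>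
    case False
    then have "p = monom 1 d \<or> q = monom 1 d"
      using root_poly_eq_monom[OF A(2)] root_poly_eq_monom[OF B(2)] A(1) B(1) sz by metis
    then have "sym_mult_conv d p q = monom 1 d"
      using assms sym_mult_conv_monom sym_mult_conv_commute by metis
    with \<open>p = monom 1 d \<or> q = monom 1 d\<close> show ?thesis
      using S_transform_monom[OF \<open>w > 0\<close>, of d] by auto
  next
    case True
    define y where "y = M_inverse p w"
    define \<theta> where "\<theta> = M_inverse q w"
    have y: "is_M_preimage (root_poly A) w y" "\<And>a. a \<in># A \<Longrightarrow> a < y" "0 < y"
      using M_inverse_root_poly_pos[OF \<open>w > 0\<close> A(2)] True by (auto simp: y_def A(1))
    have \<theta>: "is_M_preimage (root_poly B) w \<theta>" "\<And>b. b \<in># B \<Longrightarrow> b < \<theta>" "0 < \<theta>"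
      using M_inverse_root_poly_pos[OF \<open>w > 0\<close> B(2)] True by (auto simp: \<theta>_def B(1))
    have ne: "A \<noteq> {#}" "B \<noteq> {#}" using True by auto
    then have "d > 0" "R \<noteq> {#}" using sz by (auto simp: nonempty_has_size)
    have "M_inverse r w \<le> w / (w + 1) * y * \<theta>"
    proof (rule ccontr)
      assume *: "\<not> ?thesis"
      \<comment> \<open>A value beyond the bound is positive, hence a genuine preimage and not the
        default 0.\<close>
      have "w / (w + 1) * y * \<theta> > 0" using \<open>w > 0\<close> y \<theta> by simp
      then have "M_inverse r w \<noteq> 0" using * by auto
      then have "is_M_preimage (root_poly R) w (M_inverse r w)"
        using is_M_preimage_M_inverse[of r w] R by simp
      then have "euler_op (real d * (1 + w)) r (M_inverse r w) = 0"
        using is_M_preimage_imp_euler_op_eq_0[OF \<open>R \<noteq> {#}\<close>] R sz by simp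
      moreover have "0 < euler_op (real d * (1 + w)) r (M_inverse r w)"
        unfolding r_def A(1) B(1)
      proof (rule euler_op_sym_mult_conv_pos)
        have "(real d * (1 + w) - real d) / (real d * (1 + w)) = w / (w + 1)"
        proof -
          have "real d * (1 + w) - real d = real d * w" by (simp add: algebra_simps)
          then show ?thesis using \<open>d > 0\<close> by (simp add: add.commute)
        qed
        then show "(real d * (1 + w) - real d) / (real d * (1 + w)) * y * \<theta> <
            M_inverse (sym_mult_conv d (root_poly A) (root_poly B)) w"
          using * by (simp add: r_def A(1) B(1))
        show "(\<Sum>a\<in>#A. y / (y - a)) = real d * (1 + w)" "(\<Sum>b\<in>#B. \<theta> / (\<theta> - b)) \<le> real d * (1 + w)"
          using y(1) \<theta>(1) ne sz by (auto simp: is_M_preimage_root_poly_iff)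
        show "real d < real d * (1 + w)" using \<open>d > 0\<close> \<open>w > 0\<close> by simp
      qed (use sz y \<theta> A B in auto)
      ultimately show False by simp
    qed
    then have "w / (w + 1) * M_inverse r w \<le> w / (w + 1) * (w / (w + 1) * y * \<theta>)"
      using \<open>w > 0\<close> by (intro mult_left_mono) auto
    then show ?thesis by (simp add: S_transform_def r_def y_def \<theta>_def mult_ac)
  qed
qed

end
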